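(* For the thermometer coding, for every $n\ge1$, $$\max_{k=0,\dots,n}\left|I^{(\mathrm T)}_{\mathrm{out}_k}-k\,I_{\mathrm{lsb}}\right|\ \stackrel{\mathcal D}{=}\ \sigma_u\sqrt{n}\,\max_{k=1,\dots,n}\left|B_{k/n}\right|,$$ where $\{B_t\}_{t\in[0,1]}$ is a standard Brownian bridge and $\stackrel{\mathcal D}{=}$ denotes equality in distribution.
   Context: Let $I_{u_1},\dots,I_{u_n}$ be i.i.d. normal random variables with mean $\bar I_u$ and variance $\sigma_u^2$, $\sigma_u>0$. Put $I_{\mathrm{lsb}}:=\frac1n\sum_{j=1}^n I_{u_j}$ and $I^{(\mathrm T)}_{\mathrm{out}_k}:=\sum_{j=1}^k I_{u_j}$ for $k=0,\dots,n$ (thermometer coding). A standard Brownian bridge is a process with the law of $\{W_s-sW_1\}_{s\in[0,1]}$ for a standard Wiener process $W$. *)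

theory Defs
  imports "HOL-Probability.Probability"
begin

text \<open>Path continuity is required almost surely, on the index set \<open>[0, \<infinity>)\<close>; values of \<open>W\<close> at
  negative times are irrelevant.\<close>

definition standard_wiener_process :: "'a measure \<Rightarrow> (real \<Rightarrow> 'a \<Rightarrow> real) \<Rightarrow> bool" where
  "standard_wiener_process M W \<longleftrightarrow>
     prob_space M \<and>
     (\<forall>t\<ge>0. W t \<in> borel_measurable M) \<and>
     (AE \<omega> in M. W 0 \<omega> = 0) \<and>
     (\<forall>m (t :: nat \<Rightarrow> real). 0 \<le> t 0 \<and> mono_on {..m} t \<longrightarrow>
        prob_space.indep_vars M (\<lambda>_. borel) (\<lambda>i \<omega>. W (t (Suc i)) \<omega> - W (t i) \<omega>) {..<m}) \<and>
     (\<forall>s t. 0 \<le> s \<and> s < t \<longrightarrow>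
        distributed M lborel (\<lambda>\<omega>. W t \<omega> - W s \<omega>) (normal_density 0 (sqrt (t - s)))) \<and>
     (AE \<omega> in M. continuous_on {0..} (\<lambda>t. W t \<omega>))"

definition same_process_law ::
    "'t set \<Rightarrow> 'a measure \<Rightarrow> ('t \<Rightarrow> 'a \<Rightarrow> real) \<Rightarrow> 'b measure \<Rightarrow> ('t \<Rightarrow> 'b \<Rightarrow> real) \<Rightarrow> bool" where
  "same_process_law T M X N Y \<longleftrightarrow>
     (\<forall>t\<in>T. X t \<in> borel_measurable M) \<and>
     (\<forall>t\<in>T. Y t \<in> borel_measurable N) \<and>
     distr M (\<Pi>\<^sub>M t\<in>T. borel) (\<lambda>\<omega>. \<lambda>t\<in>T. X t \<omega>) = distr N (\<Pi>\<^sub>M t\<in>T. borel) (\<lambda>\<omega>. \<lambda>t\<in>T. Y t \<omega>)"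

text \<open>The Wiener process may live on a probability space other than that of \<open>B\<close>. HOL cannot
  quantify over its sample type inside a definition, so this type is an explicit parameter;
  a theorem that assumes the predicate for an arbitrary type \<open>'c\<close> covers every such space.
  The law is the one on the product sigma-algebra over \<open>[0,1]\<close>, i.e. the finite-dimensional
  distributions; no path continuity is demanded of \<open>B\<close> itself.\<close>

definition standard_brownian_bridge ::
    "'c itself \<Rightarrow> 'b measure \<Rightarrow> (real \<Rightarrow> 'b \<Rightarrow> real) \<Rightarrow> bool" where
  "standard_brownian_bridge TYPE('c) N B \<longleftrightarrow>
     prob_space N \<and>
     (\<exists>(P :: 'c measure) W. standard_wiener_process P W \<and>
        same_process_law {0..1} N B P (\<lambda>s \<omega>. W s \<omega> - s * W 1 \<omega>))"

text \<open>Measurability is included because \<^const>\<open>distr\<close> is meaningful only for measurable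
  functions.\<close>

definition equal_in_distribution ::
    "'a measure \<Rightarrow> ('a \<Rightarrow> real) \<Rightarrow> 'b measure \<Rightarrow> ('b \<Rightarrow> real) \<Rightarrow> bool" where
  "equal_in_distribution M X N Y \<longleftrightarrow>
     X \<in> borel_measurable M \<and> Y \<in> borel_measurable N \<and> distr M borel X = distr N borel Y"

definition I_lsb :: "(nat \<Rightarrow> 'a \<Rightarrow> real) \<Rightarrow> nat \<Rightarrow> 'a \<Rightarrow> real" where
  "I_lsb Iu n \<omega> = (1 / real n) * (\<Sum>j=1..n. Iu j \<omega>)"

definition I_out_T :: "(nat \<Rightarrow> 'a \<Rightarrow> real) \<Rightarrow> nat \<Rightarrow> 'a \<Rightarrow> real" where
  "I_out_T Iu k \<omega> = (\<Sum>j=1..k. Iu j \<omega>)"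

end

theory Submission
  imports Defs
begin

text \<open>
  The left side is the maximum modulus of a discrete bridge, that is, of a partial-sum sequence
  minus its linear interpolation; so is the right side, up to equality in law and a factor, with
  the increments of a Wiener process as summands. A discrete bridge does not change when a constant is added
  to all summands, and it scales with them.

  Let \<open>W\<close> be the Wiener process behind \<open>B\<close>, and let \<open>D j = W (j / n) - W ((j - 1) / n)\<close>. These
  increments are independent \<open>N(0, 1 / n)\<close> variables, so \<open>mean_u + sigma_u * sqrt n * D j\<close> are
  independent \<open>N(mean_u, sigma_u\<^sup>2)\<close> variables. Hence they have the same joint law as the
  \<open>Iu j\<close> (\<open>independent_families_same_joint_law\<close>), so every measurable functional
  has the same law on both families, in particular the maximum modulus of the discrete bridge. By invariance and scaling
  (\<open>discrete_bridge_affine_increments\<close>), for the rescaled increments this functional is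
  \<open>sigma_u * sqrt n\<close> times the maximum of \<open>\<bar>W (k / n) - (k / n) * W 1\<bar>\<close>, up to the null event
  where \<open>W 0 \<noteq> 0\<close>. That maximum depends only on the law of the process \<open>W s - s * W 1\<close>, which is
  the law of \<open>B\<close>.
\<close>

lemma independent_families_same_joint_law:
  assumes "prob_space M" "prob_space N"
    and "prob_space.indep_vars M M' X I" "prob_space.indep_vars N M' Y I"
    and "\<And>i. i \<in> I \<Longrightarrow> distr M (M' i) (X i) = distr N (M' i) (Y i)"
    and "I \<noteq> {}"
  shows "distr M (\<Pi>\<^sub>M i\<in>I. M' i) (\<lambda>\<omega>. \<lambda>i\<in>I. X i \<omega>) = distr N (\<Pi>\<^sub>M i\<in>I. M' i) (\<lambda>\<omega>. \<lambda>i\<in>I. Y i \<omega>)"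
proof -
  interpret M: prob_space M by fact
  interpret N: prob_space N by fact
  have X: "X i \<in> measurable M (M' i)" if "i \<in> I" for i
    using assms(3) that unfolding M.indep_vars_def2 by auto
  have Y: "Y i \<in> measurable N (M' i)" if "i \<in> I" for i
    using assms(4) that unfolding N.indep_vars_def2 by auto
  have "distr M (\<Pi>\<^sub>M i\<in>I. M' i) (\<lambda>\<omega>. \<lambda>i\<in>I. X i \<omega>) = (\<Pi>\<^sub>M i\<in>I. distr M (M' i) (X i))"
    using M.indep_vars_iff_distr_eq_PiM'[of I X M'] X assms(3,6) by blast
  also have "\<dots> = (\<Pi>\<^sub>M i\<in>I. distr N (M' i) (Y i))"
    by (intro PiM_cong refl assms(5))
  also have "\<dots> = distr N (\<Pi>\<^sub>M i\<in>I. M' i) (\<lambda>\<omega>. \<lambda>i\<in>I. Y i \<omega>)"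
    using N.indep_vars_iff_distr_eq_PiM'[of I Y M'] Y assms(4,6) by (metis (no_types, lifting))
  finally show ?thesis .
qed

lemma distributed_imp_distr_eq:
  assumes "distributed M L X f" "distributed N L Y f" "sets K = sets L"
  shows "distr M K X = distr N K Y"
proof -
  have "distr M K X = distr M L X" "distr N K Y = distr N L Y"
    using assms(3) by (auto intro: distr_cong)
  with assms(1,2) show ?thesis
    by (simp add: distributed_distr_eq_density)
qed

lemma equal_in_distribution_functional:
  assumes "distr M K X = distr N K Y" "X \<in> measurable M K" "Y \<in> measurable N K"
    and "g \<in> borel_measurable K"
  shows "equal_in_distribution M (\<lambda>\<omega>. g (X \<omega>)) N (\<lambda>\<omega>. g (Y \<omega>))"
proof -
  have "distr M borel (g \<circ> X) = distr N borel (g \<circ> Y)"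
    using assms distr_distr[of g K borel X M] distr_distr[of g K borel Y N] by simp
  then show ?thesis
    using assms by (simp add: equal_in_distribution_def comp_def)
qed

lemma equal_in_distribution_sym:
  "equal_in_distribution M X N Y \<Longrightarrow> equal_in_distribution N Y M X"
  by (simp add: equal_in_distribution_def)

lemma equal_in_distribution_trans:
  "equal_in_distribution M X N Y \<Longrightarrow> equal_in_distribution N Y K Z \<Longrightarrow> equal_in_distribution M X K Z"
  by (simp add: equal_in_distribution_def)

lemma equal_in_distribution_AE_eq:
  assumes "AE \<omega> in M. X \<omega> = Y \<omega>" "X \<in> borel_measurable M" "Y \<in> borel_measurable M"
  shows "equal_in_distribution M X M Y"
  using assms by (auto simp: equal_in_distribution_def intro: distr_cong_AE)

text \<open>
  Independence of increments is given along time grids indexed from \<open>0\<close>. To index the increments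
  by \<open>{1..n}\<close> the grid starts with a repeated \<open>0\<close>: truncated subtraction gives
  \<open>real (i - 1) / real n\<close> for \<open>i = 0\<close> and \<open>i = 1\<close> alike, and the empty increment is dropped.
\<close>

lemma wiener_grid_increments_indep:
  assumes "standard_wiener_process P W"
  shows "prob_space.indep_vars P (\<lambda>_. borel)
           (\<lambda>j \<omega>. W (real j / real n) \<omega> - W (real (j - 1) / real n) \<omega>) {1..n}"
proof -
  interpret prob_space P
    using assms by (simp add: standard_wiener_process_def)
  define t :: "nat \<Rightarrow> real" where "t i = real (i - 1) / real n" for i
  have "mono_on {..Suc n} t"
    by (auto simp: t_def intro!: mono_onI divide_right_mono)
  moreover have "0 \<le> t 0"
    by (simp add: t_def)
  ultimately have "indep_vars (\<lambda>_. borel) (\<lambda>i \<omega>. W (t (Suc i)) \<omega> - W (t i) \<omega>) {..<Suc n}"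
    using assms by (simp add: standard_wiener_process_def)
  then have "indep_vars (\<lambda>_. borel) (\<lambda>i \<omega>. W (t (Suc i)) \<omega> - W (t i) \<omega>) {1..n}"
    by (rule indep_vars_subset) auto
  then show ?thesis
    by (simp add: t_def)
qed

lemma wiener_grid_increment_scaled_normal:
  assumes "standard_wiener_process P W" "j \<in> {1..n}" "s > 0"
  shows "distributed P lborel
           (\<lambda>\<omega>. m + s * sqrt (real n) * (W (real j / real n) \<omega> - W (real (j - 1) / real n) \<omega>))
           (normal_density m s)"
proof -
  interpret prob_space P
    using assms by (simp add: standard_wiener_process_def)
  have n: "n > 0" and j: "real (j - 1) = real j - 1"
    using assms(2) by auto
  have step: "real j / real n - real (j - 1) / real n = 1 / real n"
    unfolding j by (simp add: diff_divide_distrib)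
  have "0 \<le> real (j - 1) / real n" "real (j - 1) / real n < real j / real n"
    using n j by (auto simp: divide_strict_right_mono)
  then have "distributed P lborel
      (\<lambda>\<omega>. W (real j / real n) \<omega> - W (real (j - 1) / real n) \<omega>) (normal_density 0 (sqrt (1 / real n)))"
    using assms(1) unfolding standard_wiener_process_def step[symmetric] by blast
  from normal_density_affine[OF this, of "s * sqrt (real n)" m] show ?thesis
    using n assms(3) by (simp add: real_sqrt_divide)
qed

definition discrete_bridge :: "nat \<Rightarrow> (nat \<Rightarrow> real) \<Rightarrow> nat \<Rightarrow> real" where
  "discrete_bridge n x k = (\<Sum>j=1..k. x j) - real k / real n * (\<Sum>j=1..n. x j)"

lemma discrete_bridge_cong:
  assumes "\<And>j. j \<in> {1..n} \<Longrightarrow> x j = y j" "k \<le> n"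
  shows "discrete_bridge n x k = discrete_bridge n y k"
proof -
  have "(\<Sum>j=1..k. x j) = (\<Sum>j=1..k. y j)" "(\<Sum>j=1..n. x j) = (\<Sum>j=1..n. y j)"
    using assms by (auto intro!: sum.cong)
  then show ?thesis
    by (simp add: discrete_bridge_def)
qed

text \<open>
  The drift \<open>m\<close> contributes \<open>k * m\<close> both to the partial sum and to its linear interpolation, and
  the increments of \<open>w\<close> telescope.
\<close>

lemma discrete_bridge_affine_increments:
  assumes "n \<ge> 1"
  shows "discrete_bridge n (\<lambda>j. m + c * (w (real j / real n) - w (real (j - 1) / real n))) k
       = c * (w (real k / real n) - w 0 - real k / real n * (w 1 - w 0))"
proof -
  have "(\<Sum>j=1..l. m + c * (w (real j / real n) - w (real (j - 1) / real n)))
      = real l * m + c * (w (real l / real n) - w 0)" for l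
    by (induction l) (simp_all add: algebra_simps)
  then show ?thesis
    unfolding discrete_bridge_def using assms by (simp only:) (simp add: field_simps)
qed

lemma max_abs_discrete_bridge_measurable:
  "(\<lambda>x. MAX k\<in>{0..n}. \<bar>discrete_bridge n x k\<bar>) \<in> borel_measurable (\<Pi>\<^sub>M j\<in>{1..n}. borel)"
proof -
  have "(\<lambda>x. \<bar>discrete_bridge n x k\<bar>) \<in> borel_measurable (\<Pi>\<^sub>M j\<in>{1..n}. borel)"
    if "k \<in> {0..n}" for k
    using that unfolding discrete_bridge_def
    by (intro borel_measurable_abs borel_measurable_diff borel_measurable_times
        borel_measurable_const borel_measurable_sum measurable_component_singleton) auto
  then show ?thesis
    by (intro borel_measurable_Max) auto
qed

text \<open>
  The index \<open>0\<close> may be dropped because \<open>f\<close> vanishes there; the maximum over the remaining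
  indices is still nonnegative.
\<close>

lemma Max_abs_scale_drop_zero:
  fixes f :: "nat \<Rightarrow> real"
  assumes "n \<ge> 1" "c \<ge> 0" "f 0 = 0"
  shows "(MAX k\<in>{0..n}. \<bar>c * f k\<bar>) = c * (MAX k\<in>{1..n}. \<bar>f k\<bar>)"
proof -
  have "(MAX k\<in>{1..n}. \<bar>f k\<bar>) \<ge> 0"
    using assms(1) by (subst Max_ge_iff) auto
  moreover have "{0..n} = insert 0 {1..n}"
    by auto
  ultimately have "(MAX k\<in>{0..n}. \<bar>f k\<bar>) = (MAX k\<in>{1..n}. \<bar>f k\<bar>)"
    using assms by (simp add: max_def)
  moreover have "(MAX k\<in>{0..n}. \<bar>c * f k\<bar>) = c * (MAX k\<in>{0..n}. \<bar>f k\<bar>)"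
    using mono_Max_commute[of "\<lambda>y. c * y" "(\<lambda>k. \<bar>f k\<bar>) ` {0..n}"] assms(2)
    by (simp add: image_image abs_mult mono_def mult_left_mono)
  ultimately show ?thesis
    by simp
qed

theorem proposition2p2:
  fixes M :: "'a measure" and Iu :: "nat \<Rightarrow> 'a \<Rightarrow> real"
    and N :: "'b measure" and B :: "real \<Rightarrow> 'b \<Rightarrow> real"
    and mean_u sigma_u :: real and n :: nat
  assumes "n \<ge> 1"
    and "sigma_u > 0"
    and "prob_space M"
    and "prob_space.indep_vars M (\<lambda>_. borel) Iu {1..n}"
    and "\<And>j. j \<in> {1..n} \<Longrightarrow> distributed M lborel (Iu j) (normal_density mean_u sigma_u)"
    and "standard_brownian_bridge TYPE('c) N B"
  shows "equal_in_distribution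
           M (\<lambda>\<omega>. MAX k\<in>{0..n}. \<bar>I_out_T Iu k \<omega> - real k * I_lsb Iu n \<omega>\<bar>)
           N (\<lambda>\<omega>. sigma_u * sqrt (real n) * (MAX k\<in>{1..n}. \<bar>B (real k / real n) \<omega>\<bar>))"
proof -
  interpret M: prob_space M by fact
  obtain P :: "'c measure" and W where W: "standard_wiener_process P W"
    and law: "same_process_law {0..1} N B P (\<lambda>s \<omega>. W s \<omega> - s * W 1 \<omega>)"
    using assms(6) unfolding standard_brownian_bridge_def by blast
  interpret P: prob_space P
    using W by (simp add: standard_wiener_process_def)
  define c where "c = sigma_u * sqrt (real n)"
  define D where "D j \<omega> = W (real j / real n) \<omega> - W (real (j - 1) / real n) \<omega>" for j \<omega>
  define X where "X j \<omega> = mean_u + c * D j \<omega>" for j \<omega>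
  define G where "G x = (MAX k\<in>{0..n}. \<bar>discrete_bridge n x k\<bar>)" for x
  define H where "H f = c * (MAX k\<in>{1..n}. \<bar>f (real k / real n)\<bar>)" for f :: "real \<Rightarrow> real"
  have c: "c \<ge> 0"
    using assms(2) by (simp add: c_def)
  have grid: "real k / real n \<in> {0..1}" if "k \<in> {1..n}" for k
    using that by auto
  have W_meas: "W s \<in> borel_measurable P" if "0 \<le> s" for s
    using W that by (simp add: standard_wiener_process_def)

  have X_indep: "P.indep_vars (\<lambda>_. borel) X {1..n}"
    unfolding X_def D_def using wiener_grid_increments_indep[OF W]
    by (rule P.indep_vars_compose2[where Y = "\<lambda>_ x. mean_u + c * x"]) simp
  have "distr M borel (Iu j) = distr P borel (X j)" if "j \<in> {1..n}" for j
    using assms(5)[OF that] wiener_grid_increment_scaled_normal[OF W that assms(2), of mean_u]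
    unfolding X_def D_def c_def by (rule distributed_imp_distr_eq) simp
  then have joint: "distr M (\<Pi>\<^sub>M j\<in>{1..n}. borel) (\<lambda>\<omega>. \<lambda>j\<in>{1..n}. Iu j \<omega>)
      = distr P (\<Pi>\<^sub>M j\<in>{1..n}. borel) (\<lambda>\<omega>. \<lambda>j\<in>{1..n}. X j \<omega>)"
    using assms(1,4) X_indep
    by (intro independent_families_same_joint_law M.prob_space_axioms P.prob_space_axioms) auto
  have G_restrict: "G (\<lambda>j\<in>{1..n}. x j) = G x" for x
    unfolding G_def by (intro arg_cong[where f = Max] image_cong arg_cong[where f = abs]
        discrete_bridge_cong) auto
  have I_eq: "G (\<lambda>j. Iu j \<omega>) = (MAX k\<in>{0..n}. \<bar>I_out_T Iu k \<omega> - real k * I_lsb Iu n \<omega>\<bar>)" for \<omega>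
    by (simp add: G_def discrete_bridge_def I_out_T_def I_lsb_def)
  have "equal_in_distribution M (\<lambda>\<omega>. G (\<lambda>j\<in>{1..n}. Iu j \<omega>)) P (\<lambda>\<omega>. G (\<lambda>j\<in>{1..n}. X j \<omega>))"
    using joint
  proof (rule equal_in_distribution_functional)
    show "(\<lambda>\<omega>. \<lambda>j\<in>{1..n}. Iu j \<omega>) \<in> measurable M (\<Pi>\<^sub>M j\<in>{1..n}. borel)"
      using assms(4) unfolding M.indep_vars_def2 by (intro measurable_restrict) auto
    show "(\<lambda>\<omega>. \<lambda>j\<in>{1..n}. X j \<omega>) \<in> measurable P (\<Pi>\<^sub>M j\<in>{1..n}. borel)"
      using X_indep unfolding P.indep_vars_def2 by (intro measurable_restrict) auto
    show "G \<in> borel_measurable (\<Pi>\<^sub>M j\<in>{1..n}. borel)"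
      unfolding G_def by (rule max_abs_discrete_bridge_measurable)
  qed
  then have Iu_X: "equal_in_distribution
      M (\<lambda>\<omega>. MAX k\<in>{0..n}. \<bar>I_out_T Iu k \<omega> - real k * I_lsb Iu n \<omega>\<bar>) P (\<lambda>\<omega>. G (\<lambda>j. X j \<omega>))"
    by (simp only: G_restrict I_eq)

  have "AE \<omega> in P. W 0 \<omega> = 0"
    using W by (simp add: standard_wiener_process_def)
  then have "AE \<omega> in P. G (\<lambda>j. X j \<omega>) = H (\<lambda>s. W s \<omega> - s * W 1 \<omega>)"
  proof eventually_elim
    case (elim \<omega>)
    have "discrete_bridge n (\<lambda>j. X j \<omega>) k = c * (W (real k / real n) \<omega> - real k / real n * W 1 \<omega>)" for k
      using discrete_bridge_affine_increments[OF assms(1), of mean_u c "\<lambda>s. W s \<omega>" k] elim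
      by (simp add: X_def D_def)
    then show ?case
      unfolding G_def H_def using Max_abs_scale_drop_zero[OF assms(1) c] elim by simp
  qed
  moreover have "(\<lambda>\<omega>. H (\<lambda>s. W s \<omega> - s * W 1 \<omega>)) \<in> borel_measurable P"
    unfolding H_def
    by (intro borel_measurable_times borel_measurable_const borel_measurable_Max
        borel_measurable_abs borel_measurable_diff W_meas) auto
  ultimately have X_W: "equal_in_distribution P (\<lambda>\<omega>. G (\<lambda>j. X j \<omega>)) P (\<lambda>\<omega>. H (\<lambda>s. W s \<omega> - s * W 1 \<omega>))"
    using Iu_X by (intro equal_in_distribution_AE_eq) (auto simp: equal_in_distribution_def)

  have H_restrict: "H (\<lambda>s\<in>{0..1}. f s) = H f" for f
  proof -
    have "(\<lambda>k. \<bar>(\<lambda>s\<in>{0..1}. f s) (real k / real n)\<bar>) ` {1..n} = (\<lambda>k. \<bar>f (real k / real n)\<bar>) ` {1..n}"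
      by (intro image_cong refl) (simp only: restrict_apply' grid)
    then show ?thesis
      by (simp only: H_def)
  qed
  have "distr N (\<Pi>\<^sub>M s\<in>{0..1}. borel) (\<lambda>\<omega>. \<lambda>s\<in>{0..1}. B s \<omega>)
      = distr P (\<Pi>\<^sub>M s\<in>{0..1}. borel) (\<lambda>\<omega>. \<lambda>s\<in>{0..1}. W s \<omega> - s * W 1 \<omega>)"
    using law by (simp add: same_process_law_def)
  then have "equal_in_distribution N (\<lambda>\<omega>. H (\<lambda>s\<in>{0..1}. B s \<omega>))
      P (\<lambda>\<omega>. H (\<lambda>s\<in>{0..1}. W s \<omega> - s * W 1 \<omega>))"
  proof (rule equal_in_distribution_functional)
    show "(\<lambda>\<omega>. \<lambda>s\<in>{0..1}. B s \<omega>) \<in> measurable N (\<Pi>\<^sub>M s\<in>{0..1}. borel)"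
      using law unfolding same_process_law_def by (intro measurable_restrict) blast
    show "(\<lambda>\<omega>. \<lambda>s\<in>{0..1}. W s \<omega> - s * W 1 \<omega>) \<in> measurable P (\<Pi>\<^sub>M s\<in>{0..1}. borel)"
      using law unfolding same_process_law_def by (intro measurable_restrict) blast
    show "H \<in> borel_measurable (\<Pi>\<^sub>M s\<in>{0..1}. borel)"
      unfolding H_def using grid
      by (intro borel_measurable_times borel_measurable_const borel_measurable_Max
          borel_measurable_abs measurable_component_singleton) auto
  qed
  then have "equal_in_distribution N (\<lambda>\<omega>. H (\<lambda>s. B s \<omega>)) P (\<lambda>\<omega>. H (\<lambda>s. W s \<omega> - s * W 1 \<omega>))"
    by (simp only: H_restrict)
  with Iu_X X_W show ?thesis
    unfolding H_def c_def by (blast intro: equal_in_distribution_trans equal_in_distribution_sym)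
qed

end
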